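(* Let $a,b$ be nonzero real numbers, and let $(\mathcal{L}_n(a,b))_{n\ge0}$ be the bi-periodic Lucas matrix sequence. Let $$\alpha=\frac{ab+\sqrt{a^2b^2+4ab}}{2},\qquad \beta=\frac{ab-\sqrt{a^2b^2+4ab}}{2}.$$ Then for every $n\in\mathbb{N}$, $$\mathcal{L}_n(a,b)=A\,\alpha^n-B\,\beta^n,$$ where $$A=\frac{b\,\mathcal{L}_1(a,b)+\alpha\,\mathcal{L}_0(a,b)-ab\,\mathcal{L}_0(a,b)}{b^{\varepsilon(n)}(ab)^{\lfloor n/2\rfloor}(\alpha-\beta)},\qquad B=\frac{b\,\mathcal{L}_1(a,b)+\beta\,\mathcal{L}_0(a,b)-ab\,\mathcal{L}_0(a,b)}{b^{\varepsilon(n)}(ab)^{\lfloor n/2\rfloor}(\alpha-\beta)}.$$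
   Context: Let $a,b$ be nonzero real numbers and $\mathbb{N}=\{0,1,2,\dots\}$. Put $\varepsilon(n)=1$ if $n$ is odd and $\varepsilon(n)=0$ if $n$ is even. The matrices $A$ and $B$ depend on $n$ through $\varepsilon(n)$ and $\lfloor n/2\rfloor$. The bi-periodic Lucas matrix sequence is defined by $$\mathcal{L}_0(a,b)=\begin{pmatrix} a & 2\\ 2\frac{a}{b} & -a\end{pmatrix},\qquad \mathcal{L}_1(a,b)=\begin{pmatrix} a^2+2\frac{a}{b} & a\\ \frac{a^2}{b} & 2\frac{a}{b}\end{pmatrix},$$ and for $n\ge 2$, $\mathcal{L}_n(a,b)=a\,\mathcal{L}_{n-1}(a,b)+\mathcal{L}_{n-2}(a,b)$ if $n$ is odd, $\mathcal{L}_n(a,b)=b\,\mathcal{L}_{n-1}(a,b)+\mathcal{L}_{n-2}(a,b)$ if $n$ is even.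
   Formalization: The formal theorem assumes α ≠ β, i.e. ab ≠ −4, because otherwise the denominators of A and B vanish (e.g. a = 1, b = −4); the square root is read as the principal complex one. *)

theory Defs
  imports "HOL-Analysis.Analysis"
begin

fun lucas_mat :: "real \<Rightarrow> real \<Rightarrow> nat \<Rightarrow> real^2^2" where
  "lucas_mat a b 0 = vector [vector [a, 2], vector [2 * (a / b), - a]]"
| "lucas_mat a b (Suc 0) =
     vector [vector [a\<^sup>2 + 2 * (a / b), a], vector [a\<^sup>2 / b, 2 * (a / b)]]"
| "lucas_mat a b (Suc (Suc n)) =
     (if odd (Suc (Suc n)) then a else b) *\<^sub>R lucas_mat a b (Suc n) + lucas_mat a b n"

text \<open>The discriminant \<open>a\<^sup>2 b\<^sup>2 + 4 a b\<close> is negative for \<open>-4 < a b < 0\<close>, so the roots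
  are complex numbers and the square root is the principal complex one, which extends
  the real square root.\<close>

definition \<alpha> :: "real \<Rightarrow> real \<Rightarrow> complex" where
  "\<alpha> a b = (of_real (a * b) + csqrt (of_real (a\<^sup>2 * b\<^sup>2 + 4 * a * b))) / 2"

definition \<beta> :: "real \<Rightarrow> real \<Rightarrow> complex" where
  "\<beta> a b = (of_real (a * b) - csqrt (of_real (a\<^sup>2 * b\<^sup>2 + 4 * a * b))) / 2"

definition \<epsilon> :: "nat \<Rightarrow> nat" where
  "\<epsilon> n = (if odd n then 1 else 0)"

text \<open>\<open>*\<^sub>R\<close> covers only real scalars.\<close>

definition mat_scale :: "'a::times \<Rightarrow> 'a^'n^'m \<Rightarrow> 'a^'n^'m" (infixr "*\<^sub>m" 75) where
  "c *\<^sub>m M = (\<chi> i j. c * M $ i $ j)"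

text \<open>The real Lucas matrices viewed as complex matrices, entry by entry.\<close>

definition lucas_cmat :: "real \<Rightarrow> real \<Rightarrow> nat \<Rightarrow> complex^2^2" where
  "lucas_cmat a b n = map_matrix complex_of_real (lucas_mat a b n)"

definition binet_denom :: "real \<Rightarrow> real \<Rightarrow> nat \<Rightarrow> complex" where
  "binet_denom a b n = of_real b ^ \<epsilon> n * of_real (a * b) ^ (n div 2) * (\<alpha> a b - \<beta> a b)"

definition binet_A :: "real \<Rightarrow> real \<Rightarrow> nat \<Rightarrow> complex^2^2" where
  "binet_A a b n = (1 / binet_denom a b n) *\<^sub>m
     (of_real b *\<^sub>m lucas_cmat a b 1 + \<alpha> a b *\<^sub>m lucas_cmat a b 0
      - of_real (a * b) *\<^sub>m lucas_cmat a b 0)"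

definition binet_B :: "real \<Rightarrow> real \<Rightarrow> nat \<Rightarrow> complex^2^2" where
  "binet_B a b n = (1 / binet_denom a b n) *\<^sub>m
     (of_real b *\<^sub>m lucas_cmat a b 1 + \<beta> a b *\<^sub>m lucas_cmat a b 0
      - of_real (a * b) *\<^sub>m lucas_cmat a b 0)"

end

theory Submission imports Defs begin

text \<open>Multiplying \<open>\<L>\<^sub>n\<close> by \<open>b\<^bsup>\<epsilon>(n)\<^esup> (a b)\<^bsup>\<lfloor>n/2\<rfloor>\<^esup>\<close> removes the parity from the recurrence: every
  entry \<open>s\<close> of the scaled sequence satisfies \<open>s\<^sub>n\<^sub>+\<^sub>2 = a b s\<^sub>n\<^sub>+\<^sub>1 + a b s\<^sub>n\<close>, whose characteristic
  roots are \<open>\<alpha>\<close> and \<open>\<beta>\<close>, so the classical Binet formula applies.\<close>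

text \<open>Keeping the factor \<open>x - y\<close> on the left avoids division, so any commutative
  ring will do. Both \<open>x ^ n\<close> and \<open>y ^ n\<close> solve the recurrence because
  \<open>x\<close> and \<open>y\<close> are roots of its characteristic polynomial;
  \<open>x + y = p\<close> makes the \<open>s 0\<close> terms cancel at index 1.\<close>

lemma binet_second_order:
  fixes s :: "nat \<Rightarrow> 'a::comm_ring_1"
  assumes rec: "\<And>n. s (Suc (Suc n)) = p * s (Suc n) + q * s n"
    and x: "x\<^sup>2 = p * x + q" and y: "y\<^sup>2 = p * y + q" and sum: "x + y = p"
  shows "(x - y) * s n = x ^ n * (s 1 + x * s 0 - p * s 0) - y ^ n * (s 1 + y * s 0 - p * s 0)"
proof (induction n rule: induct_nat_012)
  case 0
  show ?case by (simp add: algebra_simps)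
next
  case 1
  show ?case by (simp add: sum[symmetric] algebra_simps)
next
  case (ge2 n)
  define c d where "c = s 1 + x * s 0 - p * s 0" and "d = s 1 + y * s 0 - p * s 0"
  have "(x - y) * s (Suc (Suc n)) = p * ((x - y) * s (Suc n)) + q * ((x - y) * s n)"
    by (simp add: rec algebra_simps)
  also have "\<dots> = p * (x ^ Suc n * c - y ^ Suc n * d) + q * (x ^ n * c - y ^ n * d)"
    by (simp only: ge2.IH c_def d_def)
  also have "\<dots> = x ^ n * (p * x + q) * c - y ^ n * (p * y + q) * d"
    by (simp add: algebra_simps)
  also have "\<dots> = x ^ Suc (Suc n) * c - y ^ Suc (Suc n) * d"
    unfolding x[symmetric] y[symmetric] by (simp add: power2_eq_square algebra_simps)
  finally show ?case by (simp only: c_def d_def)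
qed

lemma \<alpha>_plus_\<beta>: "\<alpha> a b + \<beta> a b = of_real (a * b)"
  by (simp add: \<alpha>_def \<beta>_def field_simps)

lemma \<alpha>_square: "(\<alpha> a b)\<^sup>2 = of_real (a * b) * \<alpha> a b + of_real (a * b)"
  and \<beta>_square: "(\<beta> a b)\<^sup>2 = of_real (a * b) * \<beta> a b + of_real (a * b)"
proof -
  define r where "r = csqrt (of_real (a\<^sup>2 * b\<^sup>2 + 4 * a * b))"
  \<comment> \<open>Only the square of the complex root enters, so the sign of the discriminant
    causes no case split.\<close>
  have r: "r * r = of_real (a * b) * of_real (a * b) + 4 * of_real (a * b)"
    unfolding r_def by (simp flip: power2_eq_square add: power_mult_distrib)
  show "(\<alpha> a b)\<^sup>2 = of_real (a * b) * \<alpha> a b + of_real (a * b)"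
    "(\<beta> a b)\<^sup>2 = of_real (a * b) * \<beta> a b + of_real (a * b)"
    unfolding \<alpha>_def \<beta>_def r_def[symmetric] using r
    by (simp_all add: field_simps power2_eq_square)
qed

definition binet_scale :: "real \<Rightarrow> real \<Rightarrow> nat \<Rightarrow> complex" where
  "binet_scale a b n = of_real b ^ \<epsilon> n * of_real (a * b) ^ (n div 2)"

text \<open>The scale gains a factor ab over two steps. Over one step it gains b from even n and a
  from odd n, exactly the coefficient of the Lucas recurrence at \<open>Suc (Suc n)\<close>, so both
  parities yield the coefficient ab.\<close>

lemma binet_scale_lucas_rec:
  "binet_scale a b (Suc (Suc n)) * lucas_cmat a b (Suc (Suc n)) $ i $ j =
     of_real (a * b) * (binet_scale a b (Suc n) * lucas_cmat a b (Suc n) $ i $ j)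
     + of_real (a * b) * (binet_scale a b n * lucas_cmat a b n $ i $ j)"
  by (cases "even n")
    (auto simp: binet_scale_def lucas_cmat_def map_matrix_def \<epsilon>_def algebra_simps elim!: evenE oddE)

theorem theorem2p5:
  fixes a b :: real and n :: nat
  assumes "a \<noteq> 0" and "b \<noteq> 0"
    and "\<alpha> a b \<noteq> \<beta> a b"
  shows "lucas_cmat a b n = \<alpha> a b ^ n *\<^sub>m binet_A a b n - \<beta> a b ^ n *\<^sub>m binet_B a b n"
proof -
  have "lucas_cmat a b n $ i $ j =
      (\<alpha> a b ^ n *\<^sub>m binet_A a b n - \<beta> a b ^ n *\<^sub>m binet_B a b n) $ i $ j" for i j
  proof -
    define L where "L = (\<lambda>k. lucas_cmat a b k $ i $ j)"
    define u v where "u = of_real b * L 1 + \<alpha> a b * L 0 - of_real (a * b) * L 0"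
      and "v = of_real b * L 1 + \<beta> a b * L 0 - of_real (a * b) * L 0"
    have denom: "binet_denom a b n = (\<alpha> a b - \<beta> a b) * binet_scale a b n"
      by (simp add: binet_denom_def binet_scale_def)
    \<comment> \<open>For nonzero a and b, the roots \<alpha> and \<beta> coincide exactly when ab =
      -4.\<close>
    have nz: "binet_denom a b n \<noteq> 0"
      using assms by (simp add: binet_denom_def)
    \<comment> \<open>The scale is 1 at index 0 and b at index 1, whence the term
      \<open>of_real b * L 1\<close> in \<open>u\<close> and \<open>v\<close>.\<close>
    have "binet_denom a b n * L n = \<alpha> a b ^ n * u - \<beta> a b ^ n * v"
      using binet_second_order[of "\<lambda>k. binet_scale a b k * lucas_cmat a b k $ i $ j",
          OF binet_scale_lucas_rec \<alpha>_square \<beta>_square \<alpha>_plus_\<beta>, of n]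
      by (simp add: denom L_def u_def v_def binet_scale_def \<epsilon>_def mult.assoc)
    then have "L n = (\<alpha> a b ^ n * u - \<beta> a b ^ n * v) / binet_denom a b n"
      using nz by (metis nonzero_mult_div_cancel_left)
    also have "\<dots> = (\<alpha> a b ^ n *\<^sub>m binet_A a b n - \<beta> a b ^ n *\<^sub>m binet_B a b n) $ i $ j"
      by (simp add: binet_A_def binet_B_def mat_scale_def u_def v_def L_def diff_divide_distrib[symmetric])
    finally show ?thesis by (simp add: L_def)
  qed
  then show ?thesis by (simp add: vec_eq_iff)
qed

end
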